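(* Let $K\ge2$, let $1=s_1<s_2\le\cdots\le s_K$ be real numbers, and let $\boldsymbol{c}=(c_1,\dots,c_K)\in\mathbb{R}^K$ with $\boldsymbol{c}^T\boldsymbol{c}=1$ and $c_1=0$. Consider the problem $$(\mathrm{P})\qquad\min_{\tilde{\boldsymbol{x}}\in\mathbb{R}^K}\ \tfrac12\sum_{k=1}^K s_k\tilde x_k^2+\sum_{k=1}^K c_k\tilde x_k\quad\text{s.t. }\tilde{\boldsymbol{x}}^T\tilde{\boldsymbol{x}}=1 ,$$ and let $d=\sum_{k=2}^{K}\dfrac{c_k^2}{(s_k-1)^2}$. (i) If $d\le1$, then the vector $\tilde{\boldsymbol{x}}^\star$ with $\tilde x_k^\star=\dfrac{c_k}{1-s_k}$ for $k>1$ and $\tilde x_1^\star$ equal to either of the two values $\pm\sqrt{1-d}$ is a minimiser of $(\mathrm{P})$. (ii) Otherwise (i.e. if $d>1$), the minimiser of $(\mathrm{P})$ has $\tilde x_1=0$, and the remaining variables $(\tilde x_2,\dots,\tilde x_K)$ are a solution to the reduced problem $$\min\ \sum_{k=2}^K\Big(\tfrac12 s_k\tilde x_k^2+c_k\tilde x_k\Big)\quad\text{s.t. }\sum_{k=2}^K\tilde x_k^2=1 .$$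
   Context: "Minimiser" and "solution" mean global minimiser. *)

theory Defs
  imports "HOL-Analysis.Analysis"
begin

text \<open>
  The space of real vectors indexed by a finite set \<open>I\<close> of natural numbers is
  represented by the extensional functions \<open>I \<rightarrow>\<^sub>E UNIV\<close>, so that equality of vectors
  is equality of their components on \<open>I\<close>.
\<close>

definition unit_vectors :: "nat set \<Rightarrow> (nat \<Rightarrow> real) set" where
  "unit_vectors I = {x \<in> I \<rightarrow>\<^sub>E UNIV. (\<Sum>k\<in>I. x k * x k) = 1}"

definition full_objective ::
    "nat \<Rightarrow> (nat \<Rightarrow> real) \<Rightarrow> (nat \<Rightarrow> real) \<Rightarrow> (nat \<Rightarrow> real) \<Rightarrow> real" where
  "full_objective K s c x = 1/2 * (\<Sum>k=1..K. s k * (x k)\<^sup>2) + (\<Sum>k=1..K. c k * x k)"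

definition reduced_objective ::
    "nat \<Rightarrow> (nat \<Rightarrow> real) \<Rightarrow> (nat \<Rightarrow> real) \<Rightarrow> (nat \<Rightarrow> real) \<Rightarrow> real" where
  "reduced_objective K s c x = (\<Sum>k=2..K. 1/2 * s k * (x k)\<^sup>2 + c k * x k)"

text \<open>
  Since the objectives take values in the linearly ordered type \<^typ>\<open>real\<close>, the library
  predicate \<^const>\<open>is_arg_min\<close> expresses global minimality over the feasible set.
\<close>

definition full_minimiser ::
    "nat \<Rightarrow> (nat \<Rightarrow> real) \<Rightarrow> (nat \<Rightarrow> real) \<Rightarrow> (nat \<Rightarrow> real) \<Rightarrow> bool" where
  "full_minimiser K s c x \<longleftrightarrow>
     is_arg_min (full_objective K s c) (\<lambda>y. y \<in> unit_vectors {1..K}) x"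

definition reduced_minimiser ::
    "nat \<Rightarrow> (nat \<Rightarrow> real) \<Rightarrow> (nat \<Rightarrow> real) \<Rightarrow> (nat \<Rightarrow> real) \<Rightarrow> bool" where
  "reduced_minimiser K s c x \<longleftrightarrow>
     is_arg_min (reduced_objective K s c) (\<lambda>y. y \<in> unit_vectors {2..K}) x"

end

theory Submission
  imports Defs
begin

text \<open>
  The problem is a trust-region subproblem on the sphere with a diagonal quadratic form, and
  everything follows from its global optimality condition. Suppose a number \<open>\<mu> \<le> s k\<close> (for all
  \<open>k\<close>) and a unit vector \<open>x\<close> satisfy the stationarity equations \<open>(s k - \<mu>) x k = - c k\<close>. On the
  sphere the term \<open>\<mu> (x k)\<^sup>2 / 2\<close> adds up to a constant, so the objective may be replaced by the
  one with coefficients \<open>s k - \<mu> \<ge> 0\<close>; this is convex with unconstrained critical point \<open>x\<close>, and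
  completing the square shows that any other unit vector \<open>y\<close> has objective value larger by
  \<open>(\<Sum>k. (s k - \<mu>) (y k - x k)\<^sup>2) / 2\<close> (\<open>diagonal_objective_gap\<close>). Hence \<open>x\<close> is a minimiser, and
  the only one if \<open>\<mu> < s k\<close> for all \<open>k\<close>.

  If \<open>d \<le> 1\<close>, take \<open>\<mu> = 1 = s 1\<close>. The equation for \<open>k = 1\<close> reads \<open>0 = 0\<close> because \<open>c 1 = 0\<close>,
  so the first component is free to restore the norm: its square has to be \<open>1 - d\<close>.

  If \<open>d > 1\<close>, the candidate with \<open>\<mu> = 1\<close> is too long and \<open>\<mu>\<close> has to be lowered. The squared norm
  of the solution of the stationarity equations, \<open>\<Sum>k. (c k)\<^sup>2 / (s k - \<mu>)\<^sup>2\<close> over \<open>k \<ge> 2\<close>, is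
  \<open>d > 1\<close> at \<open>\<mu> = 1\<close> and at most \<open>\<Sum>k. (c k)\<^sup>2 = 1\<close> at \<open>\<mu> = 0\<close>, so it equals \<open>1\<close> for some
  \<open>\<mu> \<in> [0, 1)\<close> (\<open>secular_equation_solvable\<close>). Now \<open>\<mu> < s k\<close> for every \<open>k\<close>, so the minimiser is
  unique, and its first component \<open>- c 1 / (1 - \<mu>)\<close> vanishes. The remaining components satisfy the
  same optimality condition for the reduced problem.
\<close>

section \<open>Global optimality on the sphere\<close>

definition diagonal_objective ::
    "nat set \<Rightarrow> (nat \<Rightarrow> real) \<Rightarrow> (nat \<Rightarrow> real) \<Rightarrow> (nat \<Rightarrow> real) \<Rightarrow> real" where
  "diagonal_objective I s c x = (\<Sum>k\<in>I. 1/2 * s k * (x k)\<^sup>2 + c k * x k)"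

lemma full_objective_eq_diagonal: "full_objective K s c = diagonal_objective {1..K} s c"
  by (rule ext)
     (simp add: full_objective_def diagonal_objective_def sum.distrib sum_distrib_left mult.assoc)

lemma reduced_objective_eq_diagonal: "reduced_objective K s c = diagonal_objective {2..K} s c"
  by (rule ext) (simp add: reduced_objective_def diagonal_objective_def)

text \<open>
  Substituting \<open>c k = - (s k - \<mu>) x k\<close> turns each summand of the difference into
  \<open>(s k - \<mu>) (y k - x k)\<^sup>2 / 2\<close> plus \<open>\<mu> / 2\<close> times \<open>(y k)\<^sup>2 - (x k)\<^sup>2\<close>, and the latter cancel
  in the sum over two unit vectors.
\<close>

lemma diagonal_objective_gap:
  assumes x: "x \<in> unit_vectors I" and y: "y \<in> unit_vectors I"
    and stat: "\<And>k. k \<in> I \<Longrightarrow> (s k - \<mu>) * x k = - c k"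
  shows "diagonal_objective I s c y - diagonal_objective I s c x
         = (\<Sum>k\<in>I. (s k - \<mu>) * (y k - x k)\<^sup>2) / 2"
proof -
  have summand: "(1/2 * s k * (y k)\<^sup>2 + c k * y k) - (1/2 * s k * (x k)\<^sup>2 + c k * x k)
      = (s k - \<mu>) * (y k - x k)\<^sup>2 / 2 + \<mu> / 2 * (y k * y k - x k * x k)" if "k \<in> I" for k
  proof -
    have c: "c k = - ((s k - \<mu>) * x k)" using stat[OF that] by simp
    show ?thesis unfolding c by (simp add: field_simps power2_eq_square)
  qed
  have "diagonal_objective I s c y - diagonal_objective I s c x
      = (\<Sum>k\<in>I. (s k - \<mu>) * (y k - x k)\<^sup>2 / 2 + \<mu> / 2 * (y k * y k - x k * x k))"
    unfolding diagonal_objective_def sum_subtractf[symmetric] by (rule sum.cong[OF refl summand])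
  also have "\<dots> = (\<Sum>k\<in>I. (s k - \<mu>) * (y k - x k)\<^sup>2) / 2
      + \<mu> / 2 * ((\<Sum>k\<in>I. y k * y k) - (\<Sum>k\<in>I. x k * x k))"
    by (simp only: sum.distrib sum_subtractf[symmetric] sum_distrib_left sum_divide_distrib)
  also have "\<dots> = (\<Sum>k\<in>I. (s k - \<mu>) * (y k - x k)\<^sup>2) / 2"
    using x y by (simp add: unit_vectors_def)
  finally show ?thesis .
qed

lemma stationary_is_arg_min:
  assumes x: "x \<in> unit_vectors I"
    and stat: "\<And>k. k \<in> I \<Longrightarrow> (s k - \<mu>) * x k = - c k"
    and le: "\<And>k. k \<in> I \<Longrightarrow> \<mu> \<le> s k"
  shows "is_arg_min (diagonal_objective I s c) (\<lambda>y. y \<in> unit_vectors I) x"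
proof -
  have "diagonal_objective I s c x \<le> diagonal_objective I s c y" if y: "y \<in> unit_vectors I" for y
  proof -
    have "0 \<le> (\<Sum>k\<in>I. (s k - \<mu>) * (y k - x k)\<^sup>2)"
      by (intro sum_nonneg mult_nonneg_nonneg) (auto simp: le)
    then show ?thesis using diagonal_objective_gap[OF x y stat] by simp
  qed
  then show ?thesis using x by (auto simp: is_arg_min_def not_less)
qed

text \<open>Strict positivity of all weights \<open>s k - \<mu>\<close> forces a zero gap to come from equal vectors.\<close>

lemma stationary_arg_min_unique:
  assumes "finite I" and x: "x \<in> unit_vectors I"
    and stat: "\<And>k. k \<in> I \<Longrightarrow> (s k - \<mu>) * x k = - c k"
    and less: "\<And>k. k \<in> I \<Longrightarrow> \<mu> < s k"
    and min: "is_arg_min (diagonal_objective I s c) (\<lambda>y. y \<in> unit_vectors I) y"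
  shows "y = x"
proof -
  have y: "y \<in> unit_vectors I" and "diagonal_objective I s c y \<le> diagonal_objective I s c x"
    using min x by (auto simp: is_arg_min_def not_less)
  then have "(\<Sum>k\<in>I. (s k - \<mu>) * (y k - x k)\<^sup>2) \<le> 0"
    using diagonal_objective_gap[OF x y stat] by simp
  moreover have nonneg: "0 \<le> (s k - \<mu>) * (y k - x k)\<^sup>2" if "k \<in> I" for k
    using less[OF that] by simp
  ultimately have "(\<Sum>k\<in>I. (s k - \<mu>) * (y k - x k)\<^sup>2) = 0"
    using sum_nonneg[of I "\<lambda>k. (s k - \<mu>) * (y k - x k)\<^sup>2"] by fastforce
  then have zero: "(s k - \<mu>) * (y k - x k)\<^sup>2 = 0" if "k \<in> I" for k
    using sum_nonneg_eq_0_iff[OF \<open>finite I\<close> nonneg] that by simp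
  have agree: "y k = x k" if "k \<in> I" for k
    using zero[OF that] less[OF that] by simp
  show ?thesis
    using x y agree by (intro PiE_ext[of y I _ x]) (auto simp: unit_vectors_def)
qed

section \<open>The multiplier\<close>

text \<open>
  The hypothesis \<open>s k > 1\<close> keeps the poles of the secular function to the right of \<open>[0, 1]\<close> and
  makes its value at \<open>0\<close> at most \<open>\<Sum>k. (c k)\<^sup>2\<close>, so the intermediate value theorem applies.
\<close>

lemma secular_equation_solvable:
  fixes s c :: "nat \<Rightarrow> real"
  assumes gt1: "\<And>k. k \<in> I \<Longrightarrow> 1 < s k"
    and norm: "(\<Sum>k\<in>I. (c k)\<^sup>2) \<le> 1"
    and long: "1 < (\<Sum>k\<in>I. (c k)\<^sup>2 / (s k - 1)\<^sup>2)"
  obtains \<mu> where "\<mu> < 1" and "(\<Sum>k\<in>I. (c k)\<^sup>2 / (s k - \<mu>)\<^sup>2) = 1"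
proof -
  define \<phi> where "\<phi> \<mu> = (\<Sum>k\<in>I. (c k)\<^sup>2 / (s k - \<mu>)\<^sup>2)" for \<mu>
  have "(c k)\<^sup>2 / (s k)\<^sup>2 \<le> (c k)\<^sup>2" if "k \<in> I" for k
  proof -
    have "1 \<le> (s k)\<^sup>2" using gt1[OF that] by (simp add: one_le_power)
    then show ?thesis
      using gt1[OF that] mult_left_mono[of 1 "(s k)\<^sup>2" "(c k)\<^sup>2"] by (simp add: divide_le_eq)
  qed
  then have "\<phi> 0 \<le> (\<Sum>k\<in>I. (c k)\<^sup>2)" unfolding \<phi>_def by (intro sum_mono) simp
  then have "\<phi> 0 \<le> 1" using norm by simp
  moreover have "1 \<le> \<phi> 1" using long by (simp add: \<phi>_def)
  moreover have "continuous_on {0..1} \<phi>"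
    unfolding \<phi>_def by (intro continuous_intros) (use gt1 in fastforce)
  ultimately obtain \<mu> where \<mu>: "\<mu> \<le> 1" "\<phi> \<mu> = 1"
    using IVT'[of \<phi> 0 1 1] by auto
  moreover have "\<mu> \<noteq> 1" using \<mu>(2) long by (auto simp: \<phi>_def)
  ultimately show thesis using that[of \<mu>] by (simp add: \<phi>_def)
qed

section \<open>The minimisers\<close>

theorem lemma7:
  fixes K :: nat and s c :: "nat \<Rightarrow> real" and d :: real
  assumes "K \<ge> 2"
    and "s 1 = 1" and "s 1 < s 2" and "mono_on {2..K} s"
    and "(\<Sum>k=1..K. c k * c k) = 1" and "c 1 = 0"
    and "d = (\<Sum>k=2..K. (c k)\<^sup>2 / (s k - 1)\<^sup>2)"
  shows "(d \<le> 1 \<longrightarrow>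
           (\<forall>t \<in> {sqrt (1 - d), - sqrt (1 - d)}.
              full_minimiser K s c (\<lambda>k\<in>{1..K}. if k = 1 then t else c k / (1 - s k)))) \<and>
         (d > 1 \<longrightarrow>
           (\<exists>!x. full_minimiser K s c x) \<and>
           (\<forall>x. full_minimiser K s c x \<longrightarrow>
              x 1 = 0 \<and> reduced_minimiser K s c (restrict x {2..K})))"
proof (intro conjI impI)
  have interval: "{1..K} = insert 1 {2..K}" using \<open>K \<ge> 2\<close> by auto
  have split: "(\<Sum>k=1..K. f k) = f 1 + (\<Sum>k=2..K. f k)" for f :: "nat \<Rightarrow> real"
    unfolding interval by simp
  have gt1: "1 < s k" if "k \<in> {2..K}" for k
  proof -
    have "s 2 \<le> s k" using monotone_onD[OF \<open>mono_on {2..K} s\<close>, of 2 k] that by simp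
    then show ?thesis using \<open>s 1 = 1\<close> \<open>s 1 < s 2\<close> by simp
  qed
  have ge1: "1 \<le> s k" if "k \<in> {1..K}" for k
    using that gt1[of k] \<open>s 1 = 1\<close> by (cases "k = 1") auto
  {
    assume "d \<le> 1"
    show "\<forall>t \<in> {sqrt (1 - d), - sqrt (1 - d)}.
        full_minimiser K s c (\<lambda>k\<in>{1..K}. if k = 1 then t else c k / (1 - s k))"
    proof
      fix t assume "t \<in> {sqrt (1 - d), - sqrt (1 - d)}"
      then have t: "t * t = 1 - d" using \<open>d \<le> 1\<close> by auto
      define x where "x = (\<lambda>k\<in>{1..K}. if k = 1 then t else c k / (1 - s k))"
      have "x k * x k = (c k)\<^sup>2 / (s k - 1)\<^sup>2" if "k \<in> {2..K}" for k
        using that by (simp add: x_def power2_eq_square algebra_simps)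
      then have "(\<Sum>k=2..K. x k * x k) = d" using assms(7) by simp
      moreover have "x 1 = t" using \<open>K \<ge> 2\<close> by (simp add: x_def)
      ultimately have "(\<Sum>k=1..K. x k * x k) = 1"
        unfolding split using t by simp
      then have "x \<in> unit_vectors {1..K}"
        by (simp add: unit_vectors_def x_def)
      moreover have "(s k - 1) * x k = - c k" if "k \<in> {1..K}" for k
      proof (cases "k = 1")
        case True
        then show ?thesis using \<open>s 1 = 1\<close> \<open>c 1 = 0\<close> by simp
      next
        case False
        then show ?thesis using that gt1[of k] by (simp add: x_def field_simps)
      qed
      ultimately show "full_minimiser K s c (\<lambda>k\<in>{1..K}. if k = 1 then t else c k / (1 - s k))"
        unfolding full_minimiser_def full_objective_eq_diagonal x_def[symmetric]
        using ge1 by (rule stationary_is_arg_min)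
    qed
  }
  assume "1 < d"
  have "(\<Sum>k=2..K. (c k)\<^sup>2) \<le> 1"
    using assms(5) \<open>c 1 = 0\<close> unfolding split by (simp add: power2_eq_square)
  then obtain \<mu> where "\<mu> < 1" and secular: "(\<Sum>k=2..K. (c k)\<^sup>2 / (s k - \<mu>)\<^sup>2) = 1"
    using secular_equation_solvable[of "{2..K}" s c] gt1 \<open>1 < d\<close> assms(7) by metis
  have less: "\<mu> < s k" if "k \<in> {1..K}" for k
    using ge1[OF that] \<open>\<mu> < 1\<close> by simp
  define x where "x = (\<lambda>k\<in>{1..K}. - c k / (s k - \<mu>))"
  have x1: "x 1 = 0" using \<open>K \<ge> 2\<close> \<open>c 1 = 0\<close> by (simp add: x_def)
  have stat: "(s k - \<mu>) * x k = - c k" if "k \<in> {1..K}" for k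
    using that less[OF that] by (simp add: x_def)
  have "x k * x k = (c k)\<^sup>2 / (s k - \<mu>)\<^sup>2" if "k \<in> {2..K}" for k
    using that by (simp add: x_def power2_eq_square)
  then have reduced_norm: "(\<Sum>k=2..K. x k * x k) = 1" using secular by simp
  have "(\<Sum>k=1..K. x k * x k) = 1"
    unfolding split using reduced_norm x1 by simp
  then have x: "x \<in> unit_vectors {1..K}"
    by (simp add: unit_vectors_def x_def)
  have min: "full_minimiser K s c x"
    unfolding full_minimiser_def full_objective_eq_diagonal
    using x stat less_imp_le[OF less] by (rule stationary_is_arg_min)
  have unique: "y = x" if "full_minimiser K s c y" for y
    using stationary_arg_min_unique[OF finite_atLeastAtMost x stat less] that
    by (simp add: full_minimiser_def full_objective_eq_diagonal)
  have "restrict x {2..K} \<in> unit_vectors {2..K}"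
    using reduced_norm by (simp add: unit_vectors_def)
  then have reduced: "reduced_minimiser K s c (restrict x {2..K})"
    unfolding reduced_minimiser_def reduced_objective_eq_diagonal
    by (rule stationary_is_arg_min[where \<mu> = \<mu>]) (use stat less in \<open>auto intro: less_imp_le\<close>)
  show "\<exists>!x. full_minimiser K s c x" using min unique by blast
  show "\<forall>x. full_minimiser K s c x \<longrightarrow>
      x 1 = 0 \<and> reduced_minimiser K s c (restrict x {2..K})"
    using unique x1 reduced by blast
qed

end
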